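(* Let $p=(12,R)$ be the mesh pattern with $R=\{(0,0),(0,1),(0,2),(2,0),(2,1),(2,2)\}$. For every $n\ge 2$, there are exactly $n!/2$ permutations in $S_n$ avoiding $p$ (having no occurrence of $p$), and exactly $n!/2$ permutations in $S_n$ containing exactly one occurrence of $p$.
   Context: $S_n$ is the set of permutations $\pi=\pi_1\cdots\pi_n$ of $\{1,\dots,n\}$. A mesh pattern $(12,R)$ consists of the permutation $12$ and a set $R\subseteq\{0,1,2\}\times\{0,1,2\}$ of shaded boxes. An occurrence of $(12,R)$ in $\pi\in S_n$ is a pair of positions $s<t$ with $\pi_s<\pi_t$ such that, putting $s_0=0,\ s_1=s,\ s_2=t,\ s_3=n+1$ and $v_0=0,\ v_1=\pi_s,\ v_2=\pi_t,\ v_3=n+1$, for every $(i,j)\in R$ there is no position $m$ with $s_i<m<s_{i+1}$ and $v_j<\pi_m<v_{j+1}$. *)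

theory Defs
  imports Complex_Main "HOL-Combinatorics.Permutations"
begin

text \<open>
  A permutation of \<open>{1..n}\<close> is a function with \<open>\<pi> permutes {1..n}\<close>; such a function is the
  identity outside \<open>{1..n}\<close>, so these functions are in bijection with the words
  \<open>\<pi> 1, \<dots>, \<pi> n\<close>.
\<close>

definition perms :: "nat \<Rightarrow> (nat \<Rightarrow> nat) set" where
  "perms n = {\<pi>. \<pi> permutes {1..n}}"

text \<open>
  The boundaries \<open>a\<^sub>0 = 0\<close>, \<open>a\<^sub>1 = a\<close>, \<open>a\<^sub>2 = b\<close>, \<open>a\<^sub>3 = n + 1\<close> of the grid cut out by an occurrence,
  used for positions as well as for values. Only the indices 0 to 3 are meaningful.
\<close>

definition grid_line :: "nat \<Rightarrow> nat \<Rightarrow> nat \<Rightarrow> nat \<Rightarrow> nat" where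
  "grid_line n a b i = [0, a, b, n + 1] ! i"

text \<open>
  The mesh pattern \<open>(12, R)\<close> is represented by its set \<open>R\<close> of shaded boxes, the box \<open>(i, j)\<close> lying
  in column \<open>i\<close> (positions) and row \<open>j\<close> (values); \<open>R\<close> must be a subset of \<open>{0..2} \<times> {0..2}\<close>.
\<close>

definition mesh12_occurrences :: "nat \<Rightarrow> (nat \<times> nat) set \<Rightarrow> (nat \<Rightarrow> nat) \<Rightarrow> (nat \<times> nat) set" where
  "mesh12_occurrences n R \<pi> =
    {(s, t). s \<in> {1..n} \<and> t \<in> {1..n} \<and> s < t \<and> \<pi> s < \<pi> t \<and>
      (\<forall>(i, j) \<in> R. \<not> (\<exists>m \<in> {1..n}.
         grid_line n s t i < m \<and> m < grid_line n s t (i + 1) \<and>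
         grid_line n (\<pi> s) (\<pi> t) j < \<pi> m \<and> \<pi> m < grid_line n (\<pi> s) (\<pi> t) (j + 1)))}"

definition avoids_mesh12 :: "nat \<Rightarrow> (nat \<times> nat) set \<Rightarrow> (nat \<Rightarrow> nat) \<Rightarrow> bool" where
  "avoids_mesh12 n R \<pi> \<longleftrightarrow> mesh12_occurrences n R \<pi> = {}"

end

theory Submission
  imports Defs
begin

text \<open>
  The shaded region consists of the whole first and the whole last column. An entry of a
  permutation other than the two entries of the occurrence lies strictly inside some row of
  the grid, so a fully shaded column forbids every position in it: the first entry of an
  occurrence is at position \<open>1\<close> and the second at position \<open>n\<close>. A permutation therefore has
  the single occurrence \<open>(1, n)\<close> if \<open>\<pi> 1 < \<pi> n\<close>, and none if \<open>\<pi> 1 > \<pi> n\<close>. Exchanging the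
  first and the last entry matches the two kinds of permutations with each other, so each of
  them makes up half of the \<open>n!\<close> permutations.
\<close>

abbreviation (input) outer_columns :: "(nat \<times> nat) set" where
  "outer_columns \<equiv> {(0,0), (0,1), (0,2), (2,0), (2,1), (2,2)}"

text \<open>
  The three rows cover all values except the two grid lines \<open>\<pi> s\<close> and \<open>\<pi> t\<close>, which by
  injectivity are taken only at \<open>s\<close> and \<open>t\<close>. Hence the row conditions disappear and only the
  emptiness of the outer columns is left.
\<close>

lemma mesh12_occurrences_outer_columns_iff:
  assumes perm: "\<pi> permutes {1..n}"
  shows "(s, t) \<in> mesh12_occurrences n outer_columns \<pi> \<longleftrightarrow>
    s \<in> {1..n} \<and> t \<in> {1..n} \<and> s < t \<and> \<pi> s < \<pi> t \<and>
    \<not> (\<exists>m \<in> {1..n}. m < s \<or> t < m)"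
proof -
  define in_row where "in_row m \<longleftrightarrow>
    (0 < \<pi> m \<and> \<pi> m < \<pi> s) \<or> (\<pi> s < \<pi> m \<and> \<pi> m < \<pi> t) \<or> (\<pi> t < \<pi> m \<and> \<pi> m < n + 1)" for m
  have row: "in_row m" if "m \<in> {1..n}" "m \<noteq> s" "m \<noteq> t" for m
  proof -
    have "\<pi> m \<in> {1..n}"
      using permutes_in_image[OF perm] that(1) by blast
    moreover have "\<pi> m \<noteq> \<pi> s" "\<pi> m \<noteq> \<pi> t"
      using permutes_inj[OF perm] that(2,3) by (auto dest: injD)
    ultimately show ?thesis
      by (auto simp: in_row_def)
  qed
  define in_box where "in_box m i j \<longleftrightarrow>
    grid_line n s t i < m \<and> m < grid_line n s t (i + 1) \<and>
    grid_line n (\<pi> s) (\<pi> t) j < \<pi> m \<and> \<pi> m < grid_line n (\<pi> s) (\<pi> t) (j + 1)" for m i j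
  have box: "in_box m 0 0 \<or> in_box m 0 1 \<or> in_box m 0 2 \<or> in_box m 2 0 \<or> in_box m 2 1 \<or> in_box m 2 2
      \<longleftrightarrow> (m < s \<or> t < m) \<and> in_row m" if "m \<in> {1..n}" for m
  proof -
    have "0 < m" "m < n + 1"
      using that by auto
    then show ?thesis
      unfolding in_box_def in_row_def grid_line_def
      by (simp add: numeral_2_eq_2) argo
  qed
  have "(s, t) \<in> mesh12_occurrences n outer_columns \<pi> \<longleftrightarrow>
      s \<in> {1..n} \<and> t \<in> {1..n} \<and> s < t \<and> \<pi> s < \<pi> t \<and>
      (\<forall>(i, j) \<in> outer_columns. \<not> (\<exists>m \<in> {1..n}. in_box m i j))"
    unfolding mesh12_occurrences_def in_box_def by simp
  also have "(\<forall>(i, j) \<in> outer_columns. \<not> (\<exists>m \<in> {1..n}. in_box m i j)) \<longleftrightarrow>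
      (\<forall>m \<in> {1..n}. m < s \<or> t < m \<longrightarrow> \<not> in_row m)"
    (is "?L = ?R")
  proof -
    have "?L \<longleftrightarrow> (\<forall>m \<in> {1..n}. \<not> (in_box m 0 0 \<or> in_box m 0 1 \<or> in_box m 0 2 \<or>
        in_box m 2 0 \<or> in_box m 2 1 \<or> in_box m 2 2))"
      by (simp only: ball_simps bex_simps prod.case) blast
    also have "\<dots> \<longleftrightarrow> ?R"
      using box by blast
    finally show ?thesis .
  qed
  also have "s \<in> {1..n} \<and> t \<in> {1..n} \<and> s < t \<and> \<pi> s < \<pi> t \<and>
      (\<forall>m \<in> {1..n}. m < s \<or> t < m \<longrightarrow> \<not> in_row m) \<longleftrightarrow>
    s \<in> {1..n} \<and> t \<in> {1..n} \<and> s < t \<and> \<pi> s < \<pi> t \<and>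
    \<not> (\<exists>m \<in> {1..n}. m < s \<or> t < m)"
  proof -
    have "in_row m" if "s < t" "m \<in> {1..n}" "m < s \<or> t < m" for m
      using row[OF that(2)] that(1,3) by auto
    then show ?thesis
      by blast
  qed
  finally show ?thesis .
qed

lemma mesh12_occurrences_outer_columns:
  assumes "\<pi> permutes {1..n}" "n \<ge> 2"
  shows "mesh12_occurrences n outer_columns \<pi> = (if \<pi> 1 < \<pi> n then {(1, n)} else {})"
proof -
  have "(s, t) \<in> mesh12_occurrences n outer_columns \<pi> \<longleftrightarrow> \<pi> 1 < \<pi> n \<and> s = 1 \<and> t = n" for s t
  proof
    assume "(s, t) \<in> mesh12_occurrences n outer_columns \<pi>"
    then have *: "s \<in> {1..n}" "t \<in> {1..n}" "\<pi> s < \<pi> t"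
      and empty: "\<not> (\<exists>m \<in> {1..n}. m < s \<or> t < m)"
      unfolding mesh12_occurrences_outer_columns_iff[OF assms(1)] by blast+
    have "1 \<in> {1..n}" "n \<in> {1..n}"
      using assms(2) by auto
    then have "\<not> 1 < s" "\<not> t < n"
      using empty by blast+
    then have "s = 1" "t = n"
      using *(1,2) by auto
    then show "\<pi> 1 < \<pi> n \<and> s = 1 \<and> t = n"
      using *(3) by simp
  next
    assume "\<pi> 1 < \<pi> n \<and> s = 1 \<and> t = n"
    then show "(s, t) \<in> mesh12_occurrences n outer_columns \<pi>"
      unfolding mesh12_occurrences_outer_columns_iff[OF assms(1)] using assms(2) by auto
  qed
  then show ?thesis
    by auto
qed

text \<open>
  Composition with the transposition of \<open>a\<close> and \<open>b\<close> is an involution that reverses the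
  order of the values at \<open>a\<close> and \<open>b\<close>.
\<close>

lemma card_permutes_ascent_eq_descent:
  fixes a b :: "'a :: linorder"
  assumes "a \<in> S" "b \<in> S"
  shows "card {\<pi>. \<pi> permutes S \<and> \<pi> a < \<pi> b} = card {\<pi>. \<pi> permutes S \<and> \<pi> b < \<pi> a}"
proof (rule bij_betw_same_card)
  show "bij_betw (\<lambda>\<pi>. \<pi> \<circ> transpose a b)
    {\<pi>. \<pi> permutes S \<and> \<pi> a < \<pi> b} {\<pi>. \<pi> permutes S \<and> \<pi> b < \<pi> a}"
    by (rule bij_betw_byWitness[where f' = "\<lambda>\<pi>. \<pi> \<circ> transpose a b"])
      (auto simp: comp_assoc intro!: permutes_compose permutes_swap_id assms)
qed

lemma card_permutes_ascent:
  fixes a b :: "'a :: linorder"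
  assumes "finite S" "a \<in> S" "b \<in> S" "a \<noteq> b"
  shows "2 * card {\<pi>. \<pi> permutes S \<and> \<pi> a < \<pi> b} = fact (card S)"
proof -
  let ?A = "{\<pi>. \<pi> permutes S \<and> \<pi> a < \<pi> b}" and ?D = "{\<pi>. \<pi> permutes S \<and> \<pi> b < \<pi> a}"
  have "\<pi> a \<noteq> \<pi> b" if "\<pi> permutes S" for \<pi>
    using permutes_inj[OF that] assms(4) by (auto dest: injD)
  then have split: "{\<pi>. \<pi> permutes S} = ?A \<union> ?D"
    by (auto simp: neq_iff)
  have fin: "finite {\<pi>. \<pi> permutes S}"
    by (rule finite_permutations[OF assms(1)])
  have "card {\<pi>. \<pi> permutes S} = card ?A + card ?D"
    unfolding split
    by (rule card_Un_disjoint) (auto intro: finite_subset[OF _ fin])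
  then show ?thesis
    using card_permutations[OF refl assms(1)] card_permutes_ascent_eq_descent[OF assms(2,3)]
    by simp
qed

theorem theorem2p2:
  fixes n :: nat and R :: "(nat \<times> nat) set"
  assumes "n \<ge> 2"
    and "R = {(0,0), (0,1), (0,2), (2,0), (2,1), (2,2)}"
  shows "real (card {\<pi> \<in> perms n. avoids_mesh12 n R \<pi>}) = (fact n :: real) / 2
    \<and> real (card {\<pi> \<in> perms n. card (mesh12_occurrences n R \<pi>) = 1}) = (fact n :: real) / 2"
proof -
  have ends: "1 \<in> {1..n}" "n \<in> {1..n}" "1 \<noteq> n"
    using assms(1) by auto
  have occ: "mesh12_occurrences n R \<pi> = (if \<pi> 1 < \<pi> n then {(1, n)} else {})"
    if "\<pi> permutes {1..n}" for \<pi>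
    using mesh12_occurrences_outer_columns[OF that assms(1)] assms(2) by simp
  have descent: "\<pi> n < \<pi> 1 \<longleftrightarrow> \<not> \<pi> 1 < \<pi> n" if "\<pi> permutes {1..n}" for \<pi>
    using injD[OF permutes_inj[OF that], of 1 n] ends(3) by linarith
  have avoiding: "{\<pi> \<in> perms n. avoids_mesh12 n R \<pi>} = {\<pi>. \<pi> permutes {1..n} \<and> \<pi> n < \<pi> 1}"
    by (rule Collect_cong) (auto simp: perms_def avoids_mesh12_def occ descent simp del: One_nat_def split: if_splits)
  have one: "{\<pi> \<in> perms n. card (mesh12_occurrences n R \<pi>) = 1}
      = {\<pi>. \<pi> permutes {1..n} \<and> \<pi> 1 < \<pi> n}"
    by (auto simp: perms_def occ split: if_splits)
  have half: "real k = fact n / 2" if "2 * k = fact n" for k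
  proof -
    have "real (2 * k) = fact n"
      unfolding that by simp
    then show ?thesis
      by simp
  qed
  have "2 * card {\<pi>. \<pi> permutes {1..n} \<and> \<pi> n < \<pi> 1} = fact n"
    using card_permutes_ascent[of "{1..n}" n 1] ends by simp
  moreover have "2 * card {\<pi>. \<pi> permutes {1..n} \<and> \<pi> 1 < \<pi> n} = fact n"
    using card_permutes_ascent[of "{1..n}" 1 n] ends by simp
  ultimately show ?thesis
    unfolding avoiding one by (blast intro: half)
qed

end
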